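(* Let $A=(a_{ij})_{1\le i,j\le 2}\in M(2,\mathbb{Z})$ and put $$Q_A(x,y)=\frac{a_{12}x^2+(a_{22}-a_{11})xy-a_{21}y^2}{\gcd(a_{12},a_{21},a_{22}-a_{11})}.$$ Then $A$ is of Frobenius type if and only if there exist integers $x,y$ with $|Q_A(x,y)|=1$.
   Context: $M(2,\mathbb{Z})$ denotes the set of $2\times 2$ matrices with integer entries whose characteristic polynomial is irreducible over $\mathbb{Q}$. For integers $a_1,a_2$, the Frobenius matrix is $M_{a_1,a_2}=\begin{pmatrix} 0 & 1 \\ a_2 & a_1 \end{pmatrix}$. A matrix $A\in M(2,\mathbb{Z})$ is said to be of Frobenius type if there exist integers $a_1,a_2$ and a matrix $X\in SL(2,\mathbb{Z})$ such that $XAX^{-1}$ commutes with $M_{a_1,a_2}$. *)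

theory Defs
  imports "Jordan_Normal_Form.Char_Poly"
begin

text \<open>Matrix indices start at 0: the entry usually written \<open>a\<^sub>1\<^sub>2\<close> is \<open>A $$ (0, 1)\<close>.\<close>

definition M2Z :: "int mat set" where
  "M2Z = {A \<in> carrier_mat 2 2. irreducible (map_poly rat_of_int (char_poly A))}"

definition SL2Z :: "int mat set" where
  "SL2Z = {X \<in> carrier_mat 2 2. det X = 1}"

definition frobenius_mat :: "int \<Rightarrow> int \<Rightarrow> int mat" where
  "frobenius_mat a\<^sub>1 a\<^sub>2 = mat_of_rows_list 2 [[0, 1], [a\<^sub>2, a\<^sub>1]]"

text \<open>The matrix \<open>Y\<close> below is the inverse of \<open>X\<close>; it is unique, and again integral as \<open>det X = 1\<close>.\<close>

definition frobenius_type :: "int mat \<Rightarrow> bool" where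
  "frobenius_type A \<longleftrightarrow>
    (\<exists>a\<^sub>1 a\<^sub>2. \<exists>X \<in> SL2Z. \<exists>Y \<in> carrier_mat 2 2.
      inverts_mat X Y \<and> inverts_mat Y X \<and>
      (X * A * Y) * frobenius_mat a\<^sub>1 a\<^sub>2 = frobenius_mat a\<^sub>1 a\<^sub>2 * (X * A * Y))"

definition Q_form :: "int mat \<Rightarrow> int \<Rightarrow> int \<Rightarrow> rat" where
  "Q_form A x y =
    of_int (A $$ (0, 1) * x\<^sup>2 + (A $$ (1, 1) - A $$ (0, 0)) * x * y - A $$ (1, 0) * y\<^sup>2) /
    of_int (gcd (gcd (A $$ (0, 1)) (A $$ (1, 0))) (A $$ (1, 1) - A $$ (0, 0)))"

end

theory Submission
  imports Defs
begin

text \<open>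
  Let \<open>N\<close> be the numerator of \<open>Q\<^sub>A\<close> and \<open>g\<close> its denominator. For \<open>X\<close> in \<open>SL(2,\<int>)\<close> with first
  row \<open>(p, q)\<close>, the upper right entry of \<open>B = X A X\<^sup>-\<^sup>1\<close> is \<open>N(p, q)\<close>, and \<open>B\<close> commutes with a
  Frobenius matrix iff this entry divides \<open>b\<^sub>2\<^sub>1\<close> and \<open>b\<^sub>2\<^sub>2 - b\<^sub>1\<^sub>1\<close>. The gcd of
  \<open>b\<^sub>1\<^sub>2, b\<^sub>2\<^sub>1, b\<^sub>2\<^sub>2 - b\<^sub>1\<^sub>1\<close> is invariant under conjugation, so the condition says
  \<open>\<bar>N(p, q)\<bar> = g\<close>. Conversely \<open>\<bar>N(x, y)\<bar> = g \<noteq> 0\<close> forces \<open>x, y\<close> to be coprime, because \<open>g\<close>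
  divides all values of the quadratic form \<open>N\<close>; so \<open>(x, y)\<close> is the first row of some \<open>X\<close>.
\<close>

abbreviation mat2 :: "'a \<Rightarrow> 'a \<Rightarrow> 'a \<Rightarrow> 'a \<Rightarrow> 'a mat" where
  "mat2 a b c d \<equiv> mat_of_rows_list 2 [[a, b], [c, d]]"

lemma mat2_carrier [simp]: "mat2 a b c d \<in> carrier_mat 2 2"
  by (simp add: mat_of_rows_list_def numeral_2_eq_2)

lemma mat2_index [simp]:
  "mat2 a b c d $$ (0, 0) = a" "mat2 a b c d $$ (0, Suc 0) = b"
  "mat2 a b c d $$ (Suc 0, 0) = c" "mat2 a b c d $$ (Suc 0, Suc 0) = d"
  by (simp_all add: mat_of_rows_list_def)

lemma mat2_dim [simp]: "dim_row (mat2 a b c d) = 2" "dim_col (mat2 a b c d) = 2"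
  by (simp_all add: mat_of_rows_list_def)

lemma mat2_eqI:
  assumes "A \<in> carrier_mat 2 2" "B \<in> carrier_mat 2 2"
    and "A $$ (0, 0) = B $$ (0, 0)" "A $$ (0, Suc 0) = B $$ (0, Suc 0)"
    and "A $$ (Suc 0, 0) = B $$ (Suc 0, 0)" "A $$ (Suc 0, Suc 0) = B $$ (Suc 0, Suc 0)"
  shows "A = B"
  using assms by (intro eq_matI) (auto simp: numeral_2_eq_2 less_Suc_eq)

lemma mat2_cases:
  assumes "A \<in> carrier_mat 2 2"
  obtains a b c d where "A = mat2 a b c d"
  using mat2_eqI[OF assms mat2_carrier] by (metis mat2_index)

lemma mat2_eq_iff:
  "mat2 a b c d = mat2 a' b' c' d' \<longleftrightarrow> a = a' \<and> b = b' \<and> c = c' \<and> d = d'"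
  by (metis mat2_index)

lemma mat2_mult:
  fixes a b c d :: "'a :: semiring_0"
  shows "mat2 a b c d * mat2 a' b' c' d' =
    mat2 (a * a' + b * c') (a * b' + b * d') (c * a' + d * c') (c * b' + d * d')"
  by (rule mat2_eqI[OF mult_carrier_mat[OF mat2_carrier mat2_carrier] mat2_carrier])
     (simp_all add: scalar_prod_def mat_of_rows_list_def numeral_2_eq_2)

lemma one_mat2: "(1\<^sub>m 2 :: 'a :: {zero, one} mat) = mat2 1 0 0 1"
  by (rule mat2_eqI) auto

lemma det_mat2:
  fixes a b c d :: "'a :: comm_ring_1"
  shows "det (mat2 a b c d) = a * d - b * c"
proof -
  have "{..<2 :: nat} = {0, 1}"
    by auto
  then show ?thesis
    by (subst laplace_expansion_row[OF mat2_carrier, of 0])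
       (simp_all add: cofactor_def mat_delete_def det_single)
qed

lemma inverts_mat2_iff:
  fixes p q r s :: "'a :: comm_ring_1"
  assumes "p * s - q * r = 1"
  shows "inverts_mat (mat2 p q r s) (mat2 e f g h) \<and> inverts_mat (mat2 e f g h) (mat2 p q r s)
    \<longleftrightarrow> mat2 e f g h = mat2 s (- q) (- r) p" (is "?L \<longleftrightarrow> ?R")
proof
  assume ?L
  then have "p * e + q * g = 1" "p * f + q * h = 0" "r * e + s * g = 0" "r * f + s * h = 1"
    by (simp_all add: inverts_mat_def mat2_mult one_mat2 mat2_eq_iff)
  note eqs = this
  \<comment> \<open>Cramer's rule: each unknown entry times the determinant is a combination of the
    equations from the first product.\<close>
  have "e * (p * s - q * r) = s * (p * e + q * g) - q * (r * e + s * g)"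
    "f * (p * s - q * r) = s * (p * f + q * h) - q * (r * f + s * h)"
    "g * (p * s - q * r) = p * (r * e + s * g) - r * (p * e + q * g)"
    "h * (p * s - q * r) = p * (r * f + s * h) - r * (p * f + q * h)"
    by (simp_all add: algebra_simps)
  then show ?R
    unfolding mat2_eq_iff eqs assms by simp
next
  assume ?R
  then show ?L
    using assms
    by (simp add: inverts_mat_def mat2_mult one_mat2 mat2_eq_iff algebra_simps)
qed

lemma frobenius_type_mat2_iff:
  "frobenius_type (mat2 a b c d) \<longleftrightarrow>
    (\<exists>u v p q r s. p * s - q * r = 1 \<and>
      mat2 p q r s * mat2 a b c d * mat2 s (- q) (- r) p * mat2 0 1 v u =
      mat2 0 1 v u * (mat2 p q r s * mat2 a b c d * mat2 s (- q) (- r) p))"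
  (is "_ \<longleftrightarrow> ?R")
proof
  assume "frobenius_type (mat2 a b c d)"
  then obtain u v X Y where XY: "X \<in> SL2Z" "Y \<in> carrier_mat 2 2"
    "inverts_mat X Y" "inverts_mat Y X"
    "(X * mat2 a b c d * Y) * mat2 0 1 v u = mat2 0 1 v u * (X * mat2 a b c d * Y)"
    unfolding frobenius_type_def frobenius_mat_def by blast
  obtain p q r s where X: "X = mat2 p q r s"
    using XY(1) mat2_cases unfolding SL2Z_def by blast
  have det: "p * s - q * r = 1"
    using XY(1) by (simp add: SL2Z_def X det_mat2)
  obtain e f g h where Y: "Y = mat2 e f g h"
    using XY(2) mat2_cases by blast
  have "Y = mat2 s (- q) (- r) p"
    using XY(3,4) inverts_mat2_iff[OF det] unfolding X Y by blast
  then show ?R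
    using XY(5) det unfolding X by blast
next
  assume ?R
  then obtain u v p q r s where det: "p * s - q * r = 1"
    and comm: "mat2 p q r s * mat2 a b c d * mat2 s (- q) (- r) p * mat2 0 1 v u =
      mat2 0 1 v u * (mat2 p q r s * mat2 a b c d * mat2 s (- q) (- r) p)"
    by blast
  have "mat2 p q r s \<in> SL2Z"
    using det by (simp add: SL2Z_def det_mat2)
  moreover have "inverts_mat (mat2 p q r s) (mat2 s (- q) (- r) p)"
    "inverts_mat (mat2 s (- q) (- r) p) (mat2 p q r s)"
    using inverts_mat2_iff[OF det] by blast+
  ultimately show "frobenius_type (mat2 a b c d)"
    unfolding frobenius_type_def frobenius_mat_def
    using comm by (intro exI bexI[OF _ mat2_carrier] bexI[of _ "mat2 p q r s"] conjI)
qed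

text \<open>The first rows of the two products give exactly these equations; equality of the second
  rows then follows by commutativity of the ring.\<close>

lemma commute_frobenius_iff:
  fixes a b c d :: "'a :: comm_ring_1"
  shows "mat2 a b c d * mat2 0 1 v u = mat2 0 1 v u * mat2 a b c d
    \<longleftrightarrow> c = b * v \<and> d - a = b * u"
  by (auto simp: mat2_mult mat2_eq_iff algebra_simps)

text \<open>The off-diagonal entries are, up to sign, the values of one quadratic form at the rows
  \<open>(p, q)\<close> and \<open>(r, s)\<close>.\<close>

lemma conj_mat2:
  fixes a b c d :: "'a :: comm_ring_1"
  shows "mat2 p q r s * mat2 a b c d * mat2 s (- q) (- r) p =
    mat2 (p * s * a + q * s * c - p * r * b - q * r * d)
      (b * p\<^sup>2 + (d - a) * p * q - c * q\<^sup>2)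
      (- (b * r\<^sup>2 + (d - a) * r * s - c * s\<^sup>2))
      (p * s * d + p * r * b - q * r * a - q * s * c)"
  unfolding mat2_mult mat2_eq_iff by (simp add: algebra_simps power2_eq_square)

lemma gcd3_dvd:
  fixes a b c :: "'a :: semiring_gcd"
  shows "gcd (gcd a b) c dvd a" "gcd (gcd a b) c dvd b" "gcd (gcd a b) c dvd c"
  by (meson dvd_trans gcd_dvd1 gcd_dvd2)+

text \<open>Here \<open>b'\<close>, \<open>c'\<close> and \<open>e'\<close> are the off-diagonal
  entries and the diagonal difference after conjugation. Each triple is an integral linear
  combination of the other, so both have the same common divisors.\<close>

lemma gcd_conj:
  fixes b c e :: int
  assumes det: "p * s - q * r = 1"
    and b': "b' = b * p\<^sup>2 + e * p * q - c * q\<^sup>2"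
    and c': "c' = - (b * r\<^sup>2 + e * r * s - c * s\<^sup>2)"
    and e': "e' = 2 * p * r * b + (p * s + q * r) * e - 2 * q * s * c"
  shows "gcd (gcd b' c') e' = gcd (gcd b c) e"
proof (rule zdvd_antisym_nonneg)
  \<comment> \<open>The same substitution for the inverse matrix, with \<open>s, - q, - r, p\<close>
    in place of \<open>p, q, r, s\<close>, undoes the first one up to the squared
    determinant.\<close>
  have "b' * s\<^sup>2 - e' * s * q - c' * q\<^sup>2 = b * (p * s - q * r)\<^sup>2"
    and "c' * p\<^sup>2 + e' * r * p - b' * r\<^sup>2 = c * (p * s - q * r)\<^sup>2"
    and "e' * (p * s + q * r) - 2 * r * s * b' + 2 * p * q * c' = e * (p * s - q * r)\<^sup>2"
    unfolding b' c' e' by (simp_all add: algebra_simps power2_eq_square)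
  then have b: "b = b' * s\<^sup>2 - e' * s * q - c' * q\<^sup>2"
    and c: "c = c' * p\<^sup>2 + e' * r * p - b' * r\<^sup>2"
    and e: "e = e' * (p * s + q * r) - 2 * r * s * b' + 2 * p * q * c'"
    unfolding det by simp_all
  let ?g = "gcd (gcd b c) e" and ?g' = "gcd (gcd b' c') e'"
  have "h dvd b'" "h dvd c'" "h dvd e'" if "h dvd b" "h dvd c" "h dvd e" for h
    using that unfolding b' c' e' by simp_all
  from this[OF gcd3_dvd] show "?g dvd ?g'"
    by (intro gcd_greatest)
  have "h dvd b" "h dvd c" "h dvd e" if "h dvd b'" "h dvd c'" "h dvd e'" for h
    using that by (subst b, simp, subst c, simp, subst e, simp)
  from this[OF gcd3_dvd] show "?g' dvd ?g"
    by (intro gcd_greatest)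
qed simp_all

lemma frobenius_type_mat2_iff_gcd:
  "frobenius_type (mat2 a b c d) \<longleftrightarrow>
    (\<exists>p q. coprime p q \<and> \<bar>b * p\<^sup>2 + (d - a) * p * q - c * q\<^sup>2\<bar> = gcd (gcd b c) (d - a))"
proof -
  \<comment> \<open>Solvability in \<open>u\<close> and \<open>v\<close> means that
    \<open>b'\<close> divides \<open>c'\<close> and \<open>e'\<close>. By invariance of the gcd this
    depends only on the first row \<open>(p, q)\<close>.\<close>
  have key: "(\<exists>u v. mat2 p q r s * mat2 a b c d * mat2 s (- q) (- r) p * mat2 0 1 v u =
      mat2 0 1 v u * (mat2 p q r s * mat2 a b c d * mat2 s (- q) (- r) p))
    \<longleftrightarrow> \<bar>b * p\<^sup>2 + (d - a) * p * q - c * q\<^sup>2\<bar> = gcd (gcd b c) (d - a)"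
    if det: "p * s - q * r = 1" for p q r s
  proof -
    define b' where "b' = b * p\<^sup>2 + (d - a) * p * q - c * q\<^sup>2"
    define c' where "c' = - (b * r\<^sup>2 + (d - a) * r * s - c * s\<^sup>2)"
    define e' where "e' = 2 * p * r * b + (p * s + q * r) * (d - a) - 2 * q * s * c"
    have diff: "p * s * d + p * r * b - q * r * a - q * s * c
        - (p * s * a + q * s * c - p * r * b - q * r * d) = e'"
      by (simp add: e'_def algebra_simps)
    have "gcd (gcd b' c') e' = gcd (gcd b c) (d - a)"
      by (rule gcd_conj[OF det b'_def c'_def e'_def])
    moreover have "(b' dvd c' \<and> b' dvd e') \<longleftrightarrow> \<bar>b'\<bar> = gcd (gcd b' c') e'"
    proof
      assume "b' dvd c' \<and> b' dvd e'"
      then have "gcd b' c' = \<bar>b'\<bar>" "gcd b' e' = \<bar>b'\<bar>"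
        by (simp_all add: gcd_proj1_iff)
      then show "\<bar>b'\<bar> = gcd (gcd b' c') e'"
        by simp
    next
      assume "\<bar>b'\<bar> = gcd (gcd b' c') e'"
      then show "b' dvd c' \<and> b' dvd e'"
        by (metis abs_dvd_iff dvd_trans gcd_dvd1 gcd_dvd2)
    qed
    ultimately show ?thesis
      unfolding conj_mat2 commute_frobenius_iff diff b'_def[symmetric] c'_def[symmetric]
      by (auto simp: dvd_def)
  qed
  \<comment> \<open>Coprime pairs are exactly the first rows of integral matrices of determinant 1,
    so \<open>r\<close> and \<open>s\<close> can be eliminated.\<close>
  have "coprime p q \<longleftrightarrow> (\<exists>r s. p * s - q * r = 1)" for p q :: int
  proof
    assume "coprime p q"
    then obtain s r where "s * p + r * q = 1"
      using bezout_int[of p q] by auto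
    then have "p * s - q * (- r) = 1"
      by (simp add: algebra_simps)
    then show "\<exists>r s. p * s - q * r = 1"
      by blast
  next
    assume "\<exists>r s. p * s - q * r = 1"
    then obtain r s where "p * s - q * r = 1"
      by blast
    then show "coprime p q"
      by (metis coprimeI dvd_diff dvd_mult2)
  qed
  then show ?thesis
    unfolding frobenius_type_mat2_iff using key by blast
qed

lemma coprime_of_form_eq_gcd:
  fixes b c e :: int
  assumes "\<bar>b * x\<^sup>2 + e * x * y - c * y\<^sup>2\<bar> = gcd (gcd b c) e" "gcd (gcd b c) e \<noteq> 0"
  shows "coprime x y"
proof (rule coprimeI)
  fix k assume "k dvd x" "k dvd y"
  then obtain x' y' where xy: "x = k * x'" "y = k * y'"
    by (auto elim!: dvdE)
  define g where "g = gcd (gcd b c) e"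
  have "g dvd b" "g dvd c" "g dvd e"
    unfolding g_def by (fact gcd3_dvd)+
  then have "g dvd b * x'\<^sup>2 + e * x' * y' - c * y'\<^sup>2"
    by simp
  then obtain m where m: "b * x'\<^sup>2 + e * x' * y' - c * y'\<^sup>2 = g * m"
    by (elim dvdE)
  \<comment> \<open>By homogeneity a common factor \<open>k\<close> contributes
    \<open>k\<^sup>2\<close> to the value; cancelling \<open>g\<close> leaves \<open>k\<close> a
    unit.\<close>
  have "b * x\<^sup>2 + e * x * y - c * y\<^sup>2 = k\<^sup>2 * (b * x'\<^sup>2 + e * x' * y' - c * y'\<^sup>2)"
    unfolding xy by (simp add: algebra_simps power2_eq_square)
  then have "g = \<bar>g * (k\<^sup>2 * m)\<bar>"
    using assms(1) unfolding m g_def[symmetric] by (simp add: ac_simps)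
  moreover have "g > 0"
    using assms(2) by (simp add: g_def order_less_le)
  ultimately have "\<bar>k\<^sup>2 * m\<bar> = 1"
    by (simp add: abs_mult)
  then have "k * (k * m) dvd 1"
    by (simp add: power2_eq_square ac_simps)
  then show "is_unit k"
    by (rule dvd_mult_left)
qed

text \<open>If the gcd vanished, the matrix would be scalar and its characteristic polynomial the
  square of a linear polynomial, hence reducible. This makes the denominator of
  \<open>Q_form\<close> nonzero.\<close>

lemma M2Z_not_scalar:
  assumes "mat2 a b c d \<in> M2Z"
  shows "gcd (gcd b c) (d - a) \<noteq> 0"
proof
  assume "gcd (gcd b c) (d - a) = 0"
  then have eq: "b = 0" "c = 0" "d = a"
    by auto
  have "char_poly (mat2 a 0 0 a) = [:- a, 1:] * [:- a, 1:]"
    by (subst char_poly_upper_triangular[OF mat2_carrier])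
       (auto simp: upper_triangular_def diag_mat_def less_2_cases_iff upt_rec)
  then have "irreducible (map_poly rat_of_int ([:- a, 1:] * [:- a, 1:]))"
    using assms by (simp add: M2Z_def eq)
  then have "irreducible ([:- rat_of_int a, 1:] * [:- rat_of_int a, 1:])"
    by (simp add: hom_distribs)
  from irreducibleD[OF this refl] show False
    by (simp add: is_unit_pCons_iff)
qed

theorem theorem2:
  fixes A :: "int mat"
  assumes "A \<in> M2Z"
  shows "frobenius_type A \<longleftrightarrow> (\<exists>x y :: int. \<bar>Q_form A x y\<bar> = 1)"
proof -
  obtain a b c d where A: "A = mat2 a b c d"
    using assms mat2_cases unfolding M2Z_def by blast
  define g where "g = gcd (gcd b c) (d - a)"
  have "g > 0"
    using M2Z_not_scalar assms unfolding A g_def by (simp add: order_less_le)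
  have "\<bar>Q_form A x y\<bar> = 1 \<longleftrightarrow> \<bar>b * x\<^sup>2 + (d - a) * x * y - c * y\<^sup>2\<bar> = g" for x y
  proof -
    have "Q_form A x y = of_int (b * x\<^sup>2 + (d - a) * x * y - c * y\<^sup>2) / of_int g"
      by (simp add: Q_form_def A g_def)
    then have "\<bar>Q_form A x y\<bar> = of_int \<bar>b * x\<^sup>2 + (d - a) * x * y - c * y\<^sup>2\<bar> / of_int g"
      using \<open>g > 0\<close> by (simp add: abs_divide del: of_int_add of_int_diff of_int_mult)
    then show ?thesis
      using \<open>g > 0\<close> by (auto simp: divide_eq_1_iff simp del: of_int_abs)
  qed
  \<comment> \<open>Coprimality is automatic for a pair with value \<open>g\<close> up to sign, so
    the existential over coprime pairs becomes one over all pairs.\<close>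
  moreover have "coprime x y" if "\<bar>b * x\<^sup>2 + (d - a) * x * y - c * y\<^sup>2\<bar> = g" for x y
    using that \<open>g > 0\<close> unfolding g_def by (intro coprime_of_form_eq_gcd) auto
  ultimately show ?thesis
    unfolding A frobenius_type_mat2_iff_gcd g_def[symmetric] by blast
qed

end
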